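(* Let $1\le m\le n$ be integers. The complete bipartite graph $K_{m,n}$ is a unit rectangle visibility graph if $m\le 2$ and $n\le 6$, or if $m=3$ and $n\le 4$. Moreover, $K_{m,n}$ is a weak unit rectangle visibility graph if $m\le 2$ (and $n$ is arbitrary), or if $m\le 3$ and $n\le 4$.
   Context: A finite simple graph $G$ is a unit rectangle visibility graph (URVG) if its vertices $v$ can be represented by closed unit squares $S_v$ in the plane with sides parallel to the coordinate axes and with pairwise disjoint interiors (squares may touch along their boundaries), in such a way that two distinct vertices $v,w$ are adjacent if and only if there is an unobstructed non-degenerate (positive width) horizontal or vertical band of visibility joining $S_v$ and $S_w$. Here a horizontal band of visibility joining $S_v$ and $S_w$ is given by an open interval $I$ of positive length such that for every $y_0\in I$ the line $y=y_0$ meets the interiors of both $S_v$ and $S_w$, and the part of this line between $S_v$ and $S_w$ (possibly a single point if the squares touch) meets the interior of no other square of the representation; vertical bands are defined analogously with the roles of $x$ and $y$ exchanged. A graph is a weak unit rectangle visibility graph if it has such a representation in which adjacency of two vertices is only required to imply (rather than be equivalent to) the existence of such a band; equivalently, if it is a subgraph of a URVG. *)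

theory Defs
  imports "HOL-Analysis.Analysis" "Graph_Theory.Graph_Theory"
begin

text \<open>
  A finite simple graph is a \<^term>\<open>G\<close> satisfying the locale \<^const>\<open>graph\<close> (finite, symmetric, without
  loops and parallel arcs); \<open>v\<close> and \<open>w\<close> are adjacent iff \<open>v \<rightarrow>\<^bsub>G\<^esub> w\<close>. The graph \<open>K\<^sub>m\<^sub>,\<^sub>n\<close> is
  \<^const>\<open>complete_bipartite_digraph\<close>, which holds of every copy of it.
\<close>

definition closed_unit_square :: "(real \<times> real) set \<Rightarrow> bool" where
  "closed_unit_square Q \<longleftrightarrow> (\<exists>x y. Q = {x..x + 1} \<times> {y..y + 1})"

definition horizontal_line :: "real \<Rightarrow> (real \<times> real) set" where
  "horizontal_line y = {p. snd p = y}"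

text \<open>
  The points of the line at height \<open>y\<close> lying weakly between the slices of \<open>A\<close> and \<open>B\<close> at that height:
  the closed gap from one slice to the other, which is a single point if the slices touch.
\<close>

definition between_on_line :: "(real \<times> real) set \<Rightarrow> (real \<times> real) set \<Rightarrow> real \<Rightarrow> (real \<times> real) set" where
  "between_on_line A B y =
     {p \<in> horizontal_line y.
        (\<forall>a \<in> A \<inter> horizontal_line y. \<forall>b \<in> B \<inter> horizontal_line y. fst a \<le> fst p \<and> fst p \<le> fst b) \<or>
        (\<forall>a \<in> A \<inter> horizontal_line y. \<forall>b \<in> B \<inter> horizontal_line y. fst b \<le> fst p \<and> fst p \<le> fst a)}"

definition horizontal_band ::
    "'a set \<Rightarrow> ('a \<Rightarrow> (real \<times> real) set) \<Rightarrow> 'a \<Rightarrow> 'a \<Rightarrow> bool" where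
  "horizontal_band V S v w \<longleftrightarrow>
     (\<exists>c d. c < d \<and>
       (\<forall>y \<in> {c<..<d}.
          horizontal_line y \<inter> interior (S v) \<noteq> {} \<and>
          horizontal_line y \<inter> interior (S w) \<noteq> {} \<and>
          (\<forall>u \<in> V - {v, w}. between_on_line (S v) (S w) y \<inter> interior (S u) = {})))"

text \<open>Vertical bands are horizontal bands after exchanging the two coordinates.\<close>

definition vertical_band ::
    "'a set \<Rightarrow> ('a \<Rightarrow> (real \<times> real) set) \<Rightarrow> 'a \<Rightarrow> 'a \<Rightarrow> bool" where
  "vertical_band V S v w \<longleftrightarrow> horizontal_band V (\<lambda>u. prod.swap ` S u) v w"

definition sees :: "'a set \<Rightarrow> ('a \<Rightarrow> (real \<times> real) set) \<Rightarrow> 'a \<Rightarrow> 'a \<Rightarrow> bool" where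
  "sees V S v w \<longleftrightarrow> horizontal_band V S v w \<or> vertical_band V S v w"

definition unit_square_layout :: "'a set \<Rightarrow> ('a \<Rightarrow> (real \<times> real) set) \<Rightarrow> bool" where
  "unit_square_layout V S \<longleftrightarrow>
     (\<forall>v \<in> V. closed_unit_square (S v)) \<and>
     (\<forall>v \<in> V. \<forall>w \<in> V. v \<noteq> w \<longrightarrow> interior (S v) \<inter> interior (S w) = {})"

definition URVG :: "('a, 'b) pre_digraph \<Rightarrow> bool" where
  "URVG G \<longleftrightarrow> graph G \<and>
     (\<exists>S. unit_square_layout (verts G) S \<and>
       (\<forall>v \<in> verts G. \<forall>w \<in> verts G. v \<noteq> w \<longrightarrow> (v \<rightarrow>\<^bsub>G\<^esub> w \<longleftrightarrow> sees (verts G) S v w)))"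

definition weak_URVG :: "('a, 'b) pre_digraph \<Rightarrow> bool" where
  "weak_URVG G \<longleftrightarrow> graph G \<and>
     (\<exists>S. unit_square_layout (verts G) S \<and>
       (\<forall>v \<in> verts G. \<forall>w \<in> verts G. v \<noteq> w \<longrightarrow> (v \<rightarrow>\<^bsub>G\<^esub> w \<longrightarrow> sees (verts G) S v w)))"

end

theory Submission
  imports Defs
begin

text \<open>
  In the layouts for \<open>m \<le> 3\<close>, the squares of the smaller class meet corner to corner along a
  diagonal. A single square has room for two squares over each of two adjacent sides and for one
  aligned with it at each of the other sides. Around two squares there is room for one square over
  each of the four sides, reaching across the common corner, and for one square in each of the two
  off-diagonal corners; three of them leave two places on either side of the diagonal. In these
  layouts two squares of the same class either have no common projection or are separated by the
  diagonal, so vertices of the larger class can be deleted freely. In the weak case a descending staircase of arbitrarily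
  many squares is seen from the left along its lower ends and from the right along its upper ends.
\<close>

section \<open>Unit squares and their slices by horizontal lines\<close>

definition unit_square :: "real \<times> real \<Rightarrow> (real \<times> real) set" where
  "unit_square p = {fst p..fst p + 1} \<times> {snd p..snd p + 1}"

lemma interior_unit_square:
  "interior (unit_square p) = {fst p<..<fst p + 1} \<times> {snd p<..<snd p + 1}"
  by (simp add: unit_square_def interior_Times)

lemma swap_unit_square: "prod.swap ` unit_square p = unit_square (prod.swap p)"
  by (auto simp: unit_square_def product_swap)

text \<open>Exchanging coordinates turns a unit square into the unit square at the swapped corner.
  Every later claim about vertical bands is therefore the horizontal claim for
  \<open>prod.swap (p v)\<close>.\<close>

lemma vertical_band_unit_square:
  "vertical_band V (\<lambda>v. unit_square (p v)) = horizontal_band V (\<lambda>v. unit_square (prod.swap (p v)))"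
  by (simp add: vertical_band_def swap_unit_square fun_eq_iff)

lemma horizontal_line_interior_unit_square:
  "horizontal_line y \<inter> interior (unit_square p) \<noteq> {} \<longleftrightarrow> snd p < y \<and> y < snd p + 1"
proof -
  have "(fst p + 1/2, y) \<in> horizontal_line y \<inter> interior (unit_square p)" if "snd p < y" "y < snd p + 1"
    using that by (simp add: horizontal_line_def interior_unit_square)
  then have "horizontal_line y \<inter> interior (unit_square p) \<noteq> {}" if "snd p < y" "y < snd p + 1"
    using that by blast
  then show ?thesis
    by (auto simp: horizontal_line_def interior_unit_square)
qed

lemma between_on_line_commute: "between_on_line A B y = between_on_line B A y"
  by (auto simp: between_on_line_def)

lemma between_on_line_unit_square:
  assumes "fst p + 1 \<le> fst q" "snd p < y" "y < snd p + 1" "snd q < y" "y < snd q + 1"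
  shows "between_on_line (unit_square p) (unit_square q) y = {fst p + 1..fst q} \<times> {y}"
proof -
  have slice: "unit_square r \<inter> horizontal_line y = {fst r..fst r + 1} \<times> {y}"
    if "snd r < y" "y < snd r + 1" for r
    using that by (auto simp: unit_square_def horizontal_line_def)
  note slices = slice[OF assms(2,3)] slice[OF assms(4,5)]
  show ?thesis
  proof (intro set_eqI iffI)
    fix z assume "z \<in> between_on_line (unit_square p) (unit_square q) y"
    then have z: "snd z = y"
      "(\<forall>a \<in> {fst p..fst p + 1}. \<forall>b \<in> {fst q..fst q + 1}. a \<le> fst z \<and> fst z \<le> b) \<or>
       (\<forall>a \<in> {fst p..fst p + 1}. \<forall>b \<in> {fst q..fst q + 1}. b \<le> fst z \<and> fst z \<le> a)"
      unfolding between_on_line_def slices by (simp_all add: horizontal_line_def)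
    from z(2) have "fst p + 1 \<le> fst z \<and> fst z \<le> fst q"
    proof
      assume "\<forall>a \<in> {fst p..fst p + 1}. \<forall>b \<in> {fst q..fst q + 1}. a \<le> fst z \<and> fst z \<le> b"
      from bspec[OF bspec[OF this, of "fst p + 1"], of "fst q"] show ?thesis by simp
    next
      assume "\<forall>a \<in> {fst p..fst p + 1}. \<forall>b \<in> {fst q..fst q + 1}. b \<le> fst z \<and> fst z \<le> a"
      \<comment> \<open>The reversed order would force \<open>fst q + 1 \<le> fst p\<close>, against
        the first assumption.\<close>
      from bspec[OF bspec[OF this, of "fst p"], of "fst q + 1"] assms(1) show ?thesis by simp
    qed
    with z(1) show "z \<in> {fst p + 1..fst q} \<times> {y}" by (cases z) simp
  next
    fix z assume "z \<in> {fst p + 1..fst q} \<times> {y}"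
    then show "z \<in> between_on_line (unit_square p) (unit_square q) y"
      unfolding between_on_line_def slices by (auto simp: horizontal_line_def)
  qed
qed

section \<open>Symmetry, deletion of obstacles and relabelling\<close>

lemma horizontal_band_commute: "horizontal_band V S v w = horizontal_band V S w v"
  unfolding horizontal_band_def insert_commute[of v w] between_on_line_commute[of "S v"] by blast

lemma sees_commute: "sees V S v w = sees V S w v"
  by (simp add: sees_def vertical_band_def horizontal_band_commute[of V _ v w])

lemma horizontal_band_antimono:
  "V \<subseteq> V' \<Longrightarrow> horizontal_band V' S v w \<Longrightarrow> horizontal_band V S v w"
  unfolding horizontal_band_def by (meson Diff_mono order_refl subsetD)

lemma sees_antimono: "V \<subseteq> V' \<Longrightarrow> sees V' S v w \<Longrightarrow> sees V S v w"
  by (auto simp: sees_def vertical_band_def intro: horizontal_band_antimono)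

lemma horizontal_band_bij_betw:
  assumes "bij_betw \<phi> V W" "v \<in> V" "w \<in> V"
  shows "horizontal_band V (\<lambda>u. S (\<phi> u)) v w \<longleftrightarrow> horizontal_band W S (\<phi> v) (\<phi> w)"
proof -
  have "W - {\<phi> v, \<phi> w} = \<phi> ` (V - {v, w})"
    using assms by (auto simp: bij_betw_def inj_on_def)
  then show ?thesis
    by (simp add: horizontal_band_def)
qed

lemma sees_bij_betw:
  assumes "bij_betw \<phi> V W" "v \<in> V" "w \<in> V"
  shows "sees V (\<lambda>u. S (\<phi> u)) v w \<longleftrightarrow> sees W S (\<phi> v) (\<phi> w)"
  using horizontal_band_bij_betw[OF assms, of S]
    horizontal_band_bij_betw[OF assms, of "\<lambda>u. prod.swap ` S u"]
  by (simp add: sees_def vertical_band_def)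

lemma unit_square_layout_bij_betw:
  assumes "bij_betw \<phi> V W" "unit_square_layout W S"
  shows "unit_square_layout V (\<lambda>u. S (\<phi> u))"
  using assms unfolding unit_square_layout_def bij_betw_def inj_on_def by (metis imageI)

section \<open>Coordinate criteria for the presence and the absence of a band\<close>

text \<open>Since all squares have width 1, comparing left edges suffices to keep an obstacle out of
  the gap from \<open>fst (p v) + 1\<close> to \<open>fst (p w)\<close>: if \<open>u\<close> does
  not start to the right of \<open>v\<close>, its interior ends before the gap, and if it does not
  start to the left of \<open>w\<close>, its interior begins after it.\<close>

lemma horizontal_band_unit_squareI:
  assumes "c < d" "fst (p v) + 1 \<le> fst (p w)"
    and "snd (p v) \<le> c" "d \<le> snd (p v) + 1" "snd (p w) \<le> c" "d \<le> snd (p w) + 1"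
    and clear: "\<And>u. u \<in> V - {v, w} \<Longrightarrow>
      snd (p u) + 1 \<le> c \<or> d \<le> snd (p u) \<or> fst (p u) \<le> fst (p v) \<or> fst (p w) \<le> fst (p u)"
  shows "horizontal_band V (\<lambda>u. unit_square (p u)) v w"
  unfolding horizontal_band_def
proof (rule exI[of _ c], rule exI[of _ d], intro conjI ballI)
  fix y u assume y: "y \<in> {c<..<d}" and u: "u \<in> V - {v, w}"
  have "between_on_line (unit_square (p v)) (unit_square (p w)) y =
      {fst (p v) + 1..fst (p w)} \<times> {y}"
    using y assms by (intro between_on_line_unit_square) auto
  then show "between_on_line (unit_square (p v)) (unit_square (p w)) y \<inter> interior (unit_square (p u)) = {}"
    using clear[OF u] y by (auto simp: interior_unit_square)
next
  show "horizontal_line y \<inter> interior (unit_square (p v)) \<noteq> {}"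
    "horizontal_line y \<inter> interior (unit_square (p w)) \<noteq> {}" if "y \<in> {c<..<d}" for y
    using that assms by (simp_all add: horizontal_line_interior_unit_square)
qed (fact \<open>c < d\<close>)

text \<open>A sufficient condition for a band that fills the whole common range of heights. The
  minima and maxima make it symmetric in \<open>v\<close> and \<open>w\<close>, and for concrete
  corners it is plain arithmetic.\<close>

definition overlap_clear :: "'i set \<Rightarrow> ('i \<Rightarrow> real \<times> real) \<Rightarrow> 'i \<Rightarrow> 'i \<Rightarrow> bool" where
  "overlap_clear V p v w \<longleftrightarrow>
     1 \<le> \<bar>fst (p v) - fst (p w)\<bar> \<and> \<bar>snd (p v) - snd (p w)\<bar> < 1 \<and>
     (\<forall>u\<in>V - {v, w}.
        snd (p u) + 1 \<le> max (snd (p v)) (snd (p w)) \<or>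
        min (snd (p v)) (snd (p w)) + 1 \<le> snd (p u) \<or>
        fst (p u) \<le> min (fst (p v)) (fst (p w)) \<or> max (fst (p v)) (fst (p w)) \<le> fst (p u))"

lemma overlap_clear_imp_horizontal_band:
  assumes "overlap_clear V p v w"
  shows "horizontal_band V (\<lambda>u. unit_square (p u)) v w"
proof -
  \<comment> \<open>By symmetry the left square may come first. The strip is bounded by the higher
    of the two lower edges and the lower of the two upper edges.\<close>
  have *: "horizontal_band V (\<lambda>u. unit_square (p u)) v w"
    if "overlap_clear V p v w" "fst (p v) \<le> fst (p w)" for v w
    using that unfolding overlap_clear_def
    by (intro horizontal_band_unit_squareI[where c = "max (snd (p v)) (snd (p w))"
          and d = "min (snd (p v)) (snd (p w)) + 1"]) auto
  have "overlap_clear V p w v"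
    using assms
    by (simp add: overlap_clear_def insert_commute abs_minus_commute max.commute min.commute)
  then show ?thesis
    using *[of v w] *[of w v] assms horizontal_band_commute by (metis linear)
qed

lemma overlap_clear_imp_sees:
  assumes "overlap_clear V p v w \<or> overlap_clear V (\<lambda>u. prod.swap (p u)) v w"
  shows "sees V (\<lambda>u. unit_square (p u)) v w"
  using assms by (auto simp: sees_def vertical_band_unit_square intro: overlap_clear_imp_horizontal_band)

text \<open>
  The line witnessing a band can avoid any finite set \<open>F\<close> of heights, such as those at which two
  obstructing squares meet.
\<close>
lemma horizontal_band_unit_squareE:
  assumes "horizontal_band V (\<lambda>u. unit_square (p u)) v w" "finite F"
    and "1 \<le> \<bar>fst (p v) - fst (p w)\<bar>"
  obtains y where "y \<notin> F" "snd (p v) < y" "y < snd (p v) + 1" "snd (p w) < y" "y < snd (p w) + 1"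
    "\<And>u. u \<in> V - {v, w} \<Longrightarrow> y \<le> snd (p u) \<or> snd (p u) + 1 \<le> y \<or>
        fst (p u) \<le> min (fst (p v)) (fst (p w)) \<or> max (fst (p v)) (fst (p w)) \<le> fst (p u)"
proof -
  from assms(1) obtain c d where "c < d" and cd: "\<And>y. y \<in> {c<..<d} \<Longrightarrow>
      snd (p v) < y \<and> y < snd (p v) + 1 \<and> snd (p w) < y \<and> y < snd (p w) + 1 \<and>
      (\<forall>u\<in>V - {v, w}. between_on_line (unit_square (p v)) (unit_square (p w)) y \<inter>
          interior (unit_square (p u)) = {})"
    unfolding horizontal_band_def horizontal_line_interior_unit_square by blast
  have "infinite ({c<..<d} - F)"
    using \<open>c < d\<close> assms(2) by simp
  then obtain y where y: "y \<in> {c<..<d}" "y \<notin> F"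
    using infinite_imp_nonempty by blast
  have "y \<le> snd (p u) \<or> snd (p u) + 1 \<le> y \<or>
      fst (p u) \<le> min (fst (p v)) (fst (p w)) \<or> max (fst (p v)) (fst (p w)) \<le> fst (p u)"
    if u: "u \<in> V - {v, w}" for u
  proof (rule ccontr)
    define l where "l = min (fst (p v)) (fst (p w))"
    define r where "r = max (fst (p v)) (fst (p w))"
    assume "\<not> ?thesis"
    then have u': "snd (p u) < y" "y < snd (p u) + 1" "l < fst (p u)" "fst (p u) < r"
      by (auto simp: l_def r_def)
    have "l + 1 \<le> r"
      using assms(3) by (auto simp: l_def r_def)
    have "between_on_line (unit_square (p v)) (unit_square (p w)) y = {l + 1..r} \<times> {y}"
    proof (cases "fst (p v) \<le> fst (p w)")
      case True
      then show ?thesis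
        using assms(3) cd[OF y(1)] between_on_line_unit_square[of "p v" "p w" y]
        by (simp add: l_def r_def)
    next
      case False
      then show ?thesis
        using assms(3) cd[OF y(1)] between_on_line_unit_square[of "p w" "p v" y]
        by (simp add: l_def r_def between_on_line_commute)
    qed
    \<comment> \<open>The midpoint of the left edge of \<open>u\<close> and
      \<open>min r (fst (p u) + 1)\<close> is inside \<open>u\<close> and to the left of
      \<open>r\<close>. Raising it to \<open>l + 1\<close> if necessary puts it in the closed gap,
      and it stays inside \<open>u\<close> because \<open>l < fst (p u)\<close>. This also covers
      touching squares, whose gap is a single point.\<close>
    moreover have "(max (l + 1) ((fst (p u) + min r (fst (p u) + 1)) / 2), y) \<in>
        ({l + 1..r} \<times> {y}) \<inter> interior (unit_square (p u))"
      using u' \<open>l + 1 \<le> r\<close> by (auto simp: interior_unit_square min_def max_def)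
    ultimately show False
      using cd[OF y(1)] u by blast
  qed
  with that[of y] cd[OF y(1)] y(2) show thesis by blast
qed

text \<open>Either the squares have no common interior height, or at every common height outside
  \<open>F\<close> some square of \<open>B\<close> lies in the way. Naming the blockers
  \<open>B\<close> separately makes the condition independent of the remaining squares, so it
  survives their deletion. \<open>F\<close> is meant for the heights at which two blockers meet and
  neither interior is hit.\<close>

definition blocked :: "'i set \<Rightarrow> real set \<Rightarrow> ('i \<Rightarrow> real \<times> real) \<Rightarrow> 'i \<Rightarrow> 'i \<Rightarrow> bool" where
  "blocked B F p v w \<longleftrightarrow>
     1 \<le> \<bar>snd (p v) - snd (p w)\<bar> \<or>
     1 \<le> \<bar>fst (p v) - fst (p w)\<bar> \<and>
     (\<forall>y. y \<in> F \<or> y \<le> max (snd (p v)) (snd (p w)) \<or> min (snd (p v)) (snd (p w)) + 1 \<le> y \<or>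
       (\<exists>u\<in>B - {v, w}. snd (p u) < y \<and> y < snd (p u) + 1 \<and>
          min (fst (p v)) (fst (p w)) < fst (p u) \<and> fst (p u) < max (fst (p v)) (fst (p w))))"

text \<open>A band would contain a line at a height outside \<open>F\<close>. The blocker that
  \<open>B\<close> supplies at this height contradicts the clearance of that line.\<close>

lemma blocked_imp_no_horizontal_band:
  assumes "blocked B F p v w" "finite F" "B \<subseteq> V"
  shows "\<not> horizontal_band V (\<lambda>u. unit_square (p u)) v w"
proof
  assume band: "horizontal_band V (\<lambda>u. unit_square (p u)) v w"
  from band obtain c d where "c < d" and cd: "\<And>y. y \<in> {c<..<d} \<Longrightarrow>
      snd (p v) < y \<and> y < snd (p v) + 1 \<and> snd (p w) < y \<and> y < snd (p w) + 1"
    unfolding horizontal_band_def horizontal_line_interior_unit_square by blast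
  \<comment> \<open>The midpoint of the band is a common interior height, which rules out the first
    alternative of \<open>blocked\<close>.\<close>
  have "\<bar>snd (p v) - snd (p w)\<bar> < 1"
    using cd[of "(c + d) / 2"] \<open>c < d\<close> by auto
  then have far: "1 \<le> \<bar>fst (p v) - fst (p w)\<bar>"
    and B: "\<And>y. y \<in> F \<or> y \<le> max (snd (p v)) (snd (p w)) \<or> min (snd (p v)) (snd (p w)) + 1 \<le> y \<or>
       (\<exists>u\<in>B - {v, w}. snd (p u) < y \<and> y < snd (p u) + 1 \<and>
          min (fst (p v)) (fst (p w)) < fst (p u) \<and> fst (p u) < max (fst (p v)) (fst (p w)))"
    using assms(1) by (auto simp: blocked_def)
  from horizontal_band_unit_squareE[OF band assms(2) far] obtain y where y:
    "y \<notin> F" "snd (p v) < y" "y < snd (p v) + 1" "snd (p w) < y" "y < snd (p w) + 1"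
    "\<And>u. u \<in> V - {v, w} \<Longrightarrow> y \<le> snd (p u) \<or> snd (p u) + 1 \<le> y \<or>
        fst (p u) \<le> min (fst (p v)) (fst (p w)) \<or> max (fst (p v)) (fst (p w)) \<le> fst (p u)"
    by metis
  from B[of y] y(1-5) obtain u where "u \<in> B - {v, w}" "snd (p u) < y" "y < snd (p u) + 1"
    "min (fst (p v)) (fst (p w)) < fst (p u)" "fst (p u) < max (fst (p v)) (fst (p w))"
    by (auto simp: max_def min_def split: if_splits)
  with y(6)[of u] assms(3) show False by (auto simp: min_def max_def split: if_splits)
qed

lemma blocked_imp_not_sees:
  assumes "blocked B F p v w" "blocked B F (\<lambda>u. prod.swap (p u)) v w" "finite F" "B \<subseteq> V"
  shows "\<not> sees V (\<lambda>u. unit_square (p u)) v w"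
  using assms blocked_imp_no_horizontal_band[of B F]
  by (auto simp: sees_def vertical_band_unit_square)

section \<open>From corner coordinates to arbitrary copies of \<open>K_{m,n}\<close>\<close>

lemma unit_square_layoutI:
  assumes "\<And>v w. v \<in> V \<Longrightarrow> w \<in> V \<Longrightarrow> v \<noteq> w \<Longrightarrow>
    1 \<le> \<bar>fst (p v) - fst (p w)\<bar> \<or> 1 \<le> \<bar>snd (p v) - snd (p w)\<bar>"
  shows "unit_square_layout V (\<lambda>v. unit_square (p v))"
  unfolding unit_square_layout_def
proof (intro conjI ballI impI)
  show "closed_unit_square (unit_square (p v))" for v
    by (auto simp: closed_unit_square_def unit_square_def)
  show "interior (unit_square (p v)) \<inter> interior (unit_square (p w)) = {}"
    if "v \<in> V" "w \<in> V" "v \<noteq> w" for v w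
    using assms[OF that] by (auto simp: interior_unit_square)
qed

text \<open>Tagging the two classes with \<open>Inl\<close> and \<open>Inr\<close> makes adjacency a
  comparison of tags, so that layouts can be given on one concrete vertex set.\<close>

lemma complete_bipartite_digraph_numbering:
  assumes "complete_bipartite_digraph m n G"
  obtains \<phi> where "bij_betw \<phi> (verts G) ({..<m} <+> {..<n})"
    "\<And>v w. v \<in> verts G \<Longrightarrow> w \<in> verts G \<Longrightarrow> v \<rightarrow>\<^bsub>G\<^esub> w \<longleftrightarrow> isl (\<phi> v) \<noteq> isl (\<phi> w)"
proof -
  from assms obtain U V where UV: "graph G" "verts G = U \<union> V" "U \<inter> V = {}" "card U = m"
    "card V = n" "arcs_ends G = U \<times> V \<union> V \<times> U"
    by (auto simp: complete_bipartite_digraph_def)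
  interpret graph G by fact
  have "finite U" "finite V"
    using finite_verts UV(2) by auto
  with UV obtain f g where f: "bij_betw f U {..<m}" and g: "bij_betw g V {..<n}"
    by (metis card_lessThan finite_lessThan finite_same_card_bij)
  define \<phi> where "\<phi> v = (if v \<in> U then Inl (f v) else Inr (g v))" for v
  have "bij_betw (Inl \<circ> f) U (Inl ` {..<m})"
    using f by (auto simp: bij_betw_def inj_on_def)
  then have "bij_betw \<phi> U (Inl ` {..<m})"
    by (rule bij_betw_cong[THEN iffD1, rotated]) (simp add: \<phi>_def)
  moreover have "bij_betw (Inr \<circ> g) V (Inr ` {..<n})"
    using g by (auto simp: bij_betw_def inj_on_def)
  then have "bij_betw \<phi> V (Inr ` {..<n})"
    by (rule bij_betw_cong[THEN iffD1, rotated]) (use UV(3) in \<open>auto simp: \<phi>_def\<close>)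
  ultimately have "bij_betw \<phi> (U \<union> V) (Inl ` {..<m} \<union> Inr ` {..<n})"
    by (rule bij_betw_combine) auto
  then show thesis
    using UV by (intro that[of \<phi>]) (auto simp: Plus_def \<phi>_def)
qed

text \<open>One layout for the largest size \<open>N\<close> serves every \<open>n \<le> N\<close>.
  Visibility survives the deletion of squares, and non-visibility survives because all blockers
  belong to the \<open>Inl\<close> class, which stays complete.\<close>

lemma URVG_complete_bipartiteI:
  assumes G: "complete_bipartite_digraph m n G" and "n \<le> N"
    and layout: "\<And>v w. v \<in> {..<m} <+> {..<N} \<Longrightarrow> w \<in> {..<m} <+> {..<N} \<Longrightarrow> v \<noteq> w \<Longrightarrow>
      1 \<le> \<bar>fst (p v) - fst (p w)\<bar> \<or> 1 \<le> \<bar>snd (p v) - snd (p w)\<bar>"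
    and adj: "\<And>i j. i < m \<Longrightarrow> j < N \<Longrightarrow>
      overlap_clear ({..<m} <+> {..<N}) p (Inl i) (Inr j) \<or>
      overlap_clear ({..<m} <+> {..<N}) (\<lambda>u. prod.swap (p u)) (Inl i) (Inr j)"
    and F: "finite F"
    and nonadj: "\<And>v w. v \<in> {..<m} <+> {..<N} \<Longrightarrow> w \<in> {..<m} <+> {..<N} \<Longrightarrow> v \<noteq> w \<Longrightarrow>
      isl v = isl w \<Longrightarrow>
      blocked (Inl ` {..<m}) F p v w \<and> blocked (Inl ` {..<m}) F (\<lambda>u. prod.swap (p u)) v w"
  shows "URVG G"
proof -
  obtain \<phi> where \<phi>: "bij_betw \<phi> (verts G) ({..<m} <+> {..<n})"
    and arc: "\<And>v w. v \<in> verts G \<Longrightarrow> w \<in> verts G \<Longrightarrow> v \<rightarrow>\<^bsub>G\<^esub> w \<longleftrightarrow> isl (\<phi> v) \<noteq> isl (\<phi> w)"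
    using complete_bipartite_digraph_numbering[OF G] by blast
  let ?W = "{..<m} <+> {..<n}" and ?S = "\<lambda>i. unit_square (p i)"
  have sub: "?W \<subseteq> {..<m} <+> {..<N}"
    using \<open>n \<le> N\<close> by auto
  have see: "sees ?W ?S (Inl i) (Inr j)" if "i < m" "j < n" for i j
    using that \<open>n \<le> N\<close> by (intro sees_antimono[OF sub] overlap_clear_imp_sees adj) auto
  have W: "sees ?W ?S v w \<longleftrightarrow> isl v \<noteq> isl w" if "v \<in> ?W" "w \<in> ?W" "v \<noteq> w" for v w
  proof (cases "isl v = isl w")
    case True
    then have "\<not> sees ?W ?S v w"
      using nonadj[of v w] that sub F by (intro blocked_imp_not_sees[of "Inl ` {..<m}" F]) auto
    with True show ?thesis by simp
  next
    case False
    then show ?thesis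
      using that see sees_commute[of ?W ?S] by auto
  qed
  have "sees (verts G) (\<lambda>u. ?S (\<phi> u)) v w \<longleftrightarrow> v \<rightarrow>\<^bsub>G\<^esub> w"
    if "v \<in> verts G" "w \<in> verts G" "v \<noteq> w" for v w
  proof -
    have "\<phi> v \<in> ?W" "\<phi> w \<in> ?W" "\<phi> v \<noteq> \<phi> w"
      using that \<phi> by (auto simp: bij_betw_def inj_on_def)
    then show ?thesis
      using W sees_bij_betw[OF \<phi> that(1,2), of ?S] arc[OF that(1,2)] by simp
  qed
  moreover have "unit_square_layout (verts G) (\<lambda>u. ?S (\<phi> u))"
    using layout sub by (intro unit_square_layout_bij_betw[OF \<phi>] unit_square_layoutI) blast
  ultimately show ?thesis
    using G unfolding URVG_def complete_bipartite_digraph_def by blast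
qed

text \<open>Only visibility has to be preserved here, so squares of the \<open>Inl\<close> class may
  be deleted as well.\<close>

lemma weak_URVG_complete_bipartiteI:
  assumes G: "complete_bipartite_digraph m n G" and "m \<le> M"
    and layout: "\<And>v w. v \<in> {..<M} <+> {..<n} \<Longrightarrow> w \<in> {..<M} <+> {..<n} \<Longrightarrow> v \<noteq> w \<Longrightarrow>
      1 \<le> \<bar>fst (p v) - fst (p w)\<bar> \<or> 1 \<le> \<bar>snd (p v) - snd (p w)\<bar>"
    and adj: "\<And>i j. i < M \<Longrightarrow> j < n \<Longrightarrow>
      sees ({..<M} <+> {..<n}) (\<lambda>v. unit_square (p v)) (Inl i) (Inr j)"
  shows "weak_URVG G"
proof -
  obtain \<phi> where \<phi>: "bij_betw \<phi> (verts G) ({..<m} <+> {..<n})"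
    and arc: "\<And>v w. v \<in> verts G \<Longrightarrow> w \<in> verts G \<Longrightarrow> v \<rightarrow>\<^bsub>G\<^esub> w \<longleftrightarrow> isl (\<phi> v) \<noteq> isl (\<phi> w)"
    using complete_bipartite_digraph_numbering[OF G] by blast
  let ?W = "{..<m} <+> {..<n}" and ?S = "\<lambda>i. unit_square (p i)"
  have sub: "?W \<subseteq> {..<M} <+> {..<n}"
    using \<open>m \<le> M\<close> by auto
  have "sees ?W ?S (Inl i) (Inr j)" if "i < m" "j < n" for i j
    using that \<open>m \<le> M\<close> by (intro sees_antimono[OF sub] adj) auto
  then have "sees ?W ?S v w" if "v \<in> ?W" "w \<in> ?W" "isl v \<noteq> isl w" for v w
    using that sees_commute[of ?W ?S] by auto
  then have "sees (verts G) (\<lambda>u. ?S (\<phi> u)) v w"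
    if "v \<in> verts G" "w \<in> verts G" "v \<rightarrow>\<^bsub>G\<^esub> w" for v w
    using that sees_bij_betw[OF \<phi> that(1,2), of ?S] arc[OF that(1,2)] \<phi>
    by (auto simp: bij_betw_def)
  moreover have "unit_square_layout (verts G) (\<lambda>u. ?S (\<phi> u))"
    using layout sub by (intro unit_square_layout_bij_betw[OF \<phi>] unit_square_layoutI) blast
  ultimately show ?thesis
    using G unfolding weak_URVG_def complete_bipartite_digraph_def by blast
qed

section \<open>Explicit layouts for one, two and three squares in the smaller class\<close>

lemma Ball_Plus: "(\<forall>v\<in>A <+> B. P v) \<longleftrightarrow> (\<forall>a\<in>A. P (Inl a)) \<and> (\<forall>b\<in>B. P (Inr b))"
  by auto

lemma lessThan_small:
  "{..<1::nat} = {0}" "{..<2::nat} = {0, 1}" "{..<3::nat} = {0, 1, 2}" "{..<4::nat} = {0, 1, 2, 3}"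
  "{..<6::nat} = {0, 1, 2, 3, 4, 5}"
  by auto

lemma URVG_K_1_n:
  assumes "complete_bipartite_digraph 1 n G" "n \<le> 6"
  shows "URVG G"
proof -
  \<comment> \<open>Offsets \<open>-3/5\<close> and \<open>3/5\<close> differ by more than 1, so the
    two squares on one side share no projection, yet both overlap the projection of the centre.
    Distances of at least 2 separate squares on neighbouring sides. The single square opposite such
    a pair is aligned with the centre, which therefore hides all that the two sides have in
    common.\<close>
  define p :: "nat + nat \<Rightarrow> real \<times> real" where
    "p = case_sum (\<lambda>_. (0, 0))
      (\<lambda>j. [(-3/5, 2), (3/5, 4), (0, -3), (-3, 3/5), (-5, -3/5), (2, 0)] ! j)"
  have *: "\<forall>v\<in>{..<1} <+> {..<6}. \<forall>w\<in>{..<1} <+> {..<6}. v \<noteq> w \<longrightarrow>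
      1 \<le> \<bar>fst (p v) - fst (p w)\<bar> \<or> 1 \<le> \<bar>snd (p v) - snd (p w)\<bar>"
    unfolding Ball_Plus lessThan_small by (simp add: p_def)
  have **: "\<forall>i\<in>{..<1}. \<forall>j\<in>{..<6}.
      overlap_clear ({..<1} <+> {..<6}) p (Inl i) (Inr j) \<or>
      overlap_clear ({..<1} <+> {..<6}) (\<lambda>u. prod.swap (p u)) (Inl i) (Inr j)"
    unfolding overlap_clear_def Ball_Plus lessThan_small Diff_iff Ball_def[of "_ - _"]
    by (auto simp: p_def)
  have ***: "\<forall>v\<in>{..<1} <+> {..<6}. \<forall>w\<in>{..<1} <+> {..<6}. v \<noteq> w \<longrightarrow> isl v = isl w \<longrightarrow>
      blocked (Inl ` {..<1}) {} p v w \<and> blocked (Inl ` {..<1}) {} (\<lambda>u. prod.swap (p u)) v w"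
    unfolding Ball_Plus lessThan_small by (auto simp: p_def blocked_def)
  show ?thesis
    by (rule URVG_complete_bipartiteI[OF assms, of p "{}"]) (use * ** *** in auto)
qed

lemma URVG_K_2_n:
  assumes "complete_bipartite_digraph 2 n G" "n \<le> 6"
  shows "URVG G"
proof -
  \<comment> \<open>The coordinate \<open>1/2\<close> places a square evenly across the common
    corner \<open>(1, 1)\<close>. The coordinates \<open>-3/4\<close> and \<open>7/4\<close> give
    each corner square a projection overlap of \<open>1/4\<close> with one diagonal square
    vertically and with the other horizontally, and keep it at least \<open>5/4\<close> away in both
    coordinates from the rest of its class.\<close>
  define p :: "nat + nat \<Rightarrow> real \<times> real" where
    "p = case_sum (\<lambda>i. [(0, 0), (1, 1)] ! i)
      (\<lambda>j. [(1/2, 3), (1/2, -2), (-2, 1/2), (3, 1/2), (-3/4, 7/4), (7/4, -3/4)] ! j)"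
  have *: "\<forall>v\<in>{..<2} <+> {..<6}. \<forall>w\<in>{..<2} <+> {..<6}. v \<noteq> w \<longrightarrow>
      1 \<le> \<bar>fst (p v) - fst (p w)\<bar> \<or> 1 \<le> \<bar>snd (p v) - snd (p w)\<bar>"
    unfolding Ball_Plus lessThan_small by (simp add: p_def)
  have **: "\<forall>i\<in>{..<2}. \<forall>j\<in>{..<6}.
      overlap_clear ({..<2} <+> {..<6}) p (Inl i) (Inr j) \<or>
      overlap_clear ({..<2} <+> {..<6}) (\<lambda>u. prod.swap (p u)) (Inl i) (Inr j)"
    unfolding overlap_clear_def Ball_Plus lessThan_small Diff_iff Ball_def[of "_ - _"]
    by (auto simp: p_def)
  \<comment> \<open>Opposite squares share the range from \<open>1/2\<close> to \<open>3/2\<close>,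
    which the two diagonal squares cover except at \<open>1\<close>, where they meet. This is the
    exceptional height.\<close>
  have ***: "\<forall>v\<in>{..<2} <+> {..<6}. \<forall>w\<in>{..<2} <+> {..<6}. v \<noteq> w \<longrightarrow> isl v = isl w \<longrightarrow>
      blocked (Inl ` {..<2}) {1} p v w \<and> blocked (Inl ` {..<2}) {1} (\<lambda>u. prod.swap (p u)) v w"
    unfolding Ball_Plus lessThan_small by (auto simp: p_def blocked_def)
  show ?thesis
    by (rule URVG_complete_bipartiteI[OF assms, of p "{1}"]) (use * ** *** in auto)
qed

lemma URVG_K_3_n:
  assumes "complete_bipartite_digraph 3 n G" "n \<le> 4"
  shows "URVG G"
proof -
  \<comment> \<open>Each outer square straddles two consecutive diagonal squares in one direction
    and overlaps the third in the other. Any two squares of the same class differ by at least 1 in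
    both coordinates, so nothing has to be hidden and the exceptional set is empty.\<close>
  define p :: "nat + nat \<Rightarrow> real \<times> real" where
    "p = case_sum (\<lambda>i. (real i, real i))
      (\<lambda>j. [(1/2, 5/2), (5/2, 1/2), (3/2, -1/2), (-1/2, 3/2)] ! j)"
  have *: "\<forall>v\<in>{..<3} <+> {..<4}. \<forall>w\<in>{..<3} <+> {..<4}. v \<noteq> w \<longrightarrow>
      1 \<le> \<bar>fst (p v) - fst (p w)\<bar> \<or> 1 \<le> \<bar>snd (p v) - snd (p w)\<bar>"
    unfolding Ball_Plus lessThan_small by (simp add: p_def)
  have **: "\<forall>i\<in>{..<3}. \<forall>j\<in>{..<4}.
      overlap_clear ({..<3} <+> {..<4}) p (Inl i) (Inr j) \<or>
      overlap_clear ({..<3} <+> {..<4}) (\<lambda>u. prod.swap (p u)) (Inl i) (Inr j)"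
    unfolding overlap_clear_def Ball_Plus lessThan_small Diff_iff Ball_def[of "_ - _"]
    by (auto simp: p_def)
  have ***: "\<forall>v\<in>{..<3} <+> {..<4}. \<forall>w\<in>{..<3} <+> {..<4}. v \<noteq> w \<longrightarrow> isl v = isl w \<longrightarrow>
      blocked (Inl ` {..<3}) {} p v w \<and> blocked (Inl ` {..<3}) {} (\<lambda>u. prod.swap (p u)) v w"
    unfolding Ball_Plus lessThan_small by (auto simp: p_def blocked_def)
  show ?thesis
    by (rule URVG_complete_bipartiteI[OF assms, of p "{}"]) (use * ** *** in auto)
qed

section \<open>The staircase between two squares\<close>

lemma weak_URVG_K_2_n:
  assumes "complete_bipartite_digraph m n G" "m \<le> 2"
  shows "weak_URVG G"
proof -
  \<comment> \<open>The drop from one stair to the next. With \<open>n + 1\<close> in the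
    denominator, \<open>(j + 2) * e \<le> 1\<close> holds for every \<open>j < n\<close>, so even
    the lowest stair keeps a strip of height \<open>e\<close> above the level 1 at which the right
    square begins.\<close>
  define e where "e = 1 / (real n + 1)"
  have e: "0 < e"
    by (simp add: e_def)
  have le1: "real k * e \<le> 1" if "k \<le> n + 1" for k
    using that by (simp add: e_def divide_simps)
  have mono: "real j * e \<le> real k * e" if "j \<le> k" for j k
    using that e by simp
  define p :: "nat + nat \<Rightarrow> real \<times> real" where
    "p = case_sum (\<lambda>i. [(0, 0), (real n + 1, 1)] ! i) (\<lambda>j. (real j + 1, 1 - real (j + 1) * e))"
  have p [simp]: "p (Inl 0) = (0, 0)" "p (Inl (Suc 0)) = (real n + 1, 1)"
    "p (Inr j) = (real j + 1, 1 - real (j + 1) * e)" for j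
    by (simp_all add: p_def)
  let ?V = "{..<2::nat} <+> {..<n}" and ?S = "\<lambda>v. unit_square (p v)"
  have "1 \<le> \<bar>fst (p v) - fst (p w)\<bar>" if "v \<in> ?V" "w \<in> ?V" "v \<noteq> w" for v w
    using that by (auto simp: less_2_cases_iff)
  moreover have "sees ?V ?S (Inl i) (Inr j)" if "i < 2" "j < n" for i j
  proof (cases "i = 0")
    case True
    \<comment> \<open>The strip is the lowest part of stair \<open>j\<close>, between
      \<open>1 - (j + 1) * e\<close> and \<open>1 - j * e\<close>. Earlier stairs end at or above
      its upper bound, and later ones stand further right.\<close>
    have "horizontal_band ?V ?S (Inl 0) (Inr j)"
    proof (rule horizontal_band_unit_squareI)
      fix u assume "u \<in> ?V - {Inl 0, Inr j}"
      then consider "u = Inl 1" | k where "u = Inr k" "k < j" | k where "u = Inr k" "j < k"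
        by (auto simp: less_2_cases_iff) (metis linorder_neqE_nat)
      then show "snd (p u) + 1 \<le> 1 - real (j + 1) * e \<or> 1 - real j * e \<le> snd (p u) \<or>
          fst (p u) \<le> fst (p (Inl 0)) \<or> fst (p (Inr j)) \<le> fst (p u)"
        using \<open>j < n\<close> mono[of "_ + 1" j] by cases auto
    qed (use e le1[of 1] le1[of j] le1[of "j + 1"] \<open>j < n\<close> in \<open>auto simp: algebra_simps\<close>)
    with True show ?thesis by (simp add: sees_def)
  next
    case False
    \<comment> \<open>The strip is the highest part of stair \<open>j\<close>, between
      \<open>2 - (j + 2) * e\<close> and \<open>2 - (j + 1) * e\<close>. Later stairs have their
      tops at or below its lower bound, and earlier ones stand further left.\<close>
    have "horizontal_band ?V ?S (Inr j) (Inl 1)"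
    proof (rule horizontal_band_unit_squareI)
      fix u assume "u \<in> ?V - {Inr j, Inl 1}"
      then consider "u = Inl 0" | k where "u = Inr k" "k < j" | k where "u = Inr k" "j < k"
        by (auto simp: less_2_cases_iff) (metis linorder_neqE_nat)
      then show "snd (p u) + 1 \<le> 2 - real (j + 2) * e \<or> 2 - real (j + 1) * e \<le> snd (p u) \<or>
          fst (p u) \<le> fst (p (Inr j)) \<or> fst (p (Inl 1)) \<le> fst (p u)"
        using mono[of "j + 2" "_ + 1"] by cases auto
    qed (use e le1[of 1] le1[of "j + 1"] le1[of "j + 2"] \<open>j < n\<close> in \<open>auto simp: algebra_simps\<close>)
    moreover have "i = 1"
      using False that by simp
    ultimately show ?thesis
      using sees_commute[of ?V ?S] by (auto simp: sees_def)
  qed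
  ultimately show ?thesis
    by (intro weak_URVG_complete_bipartiteI[OF assms, of p]) blast+
qed

lemma URVG_imp_weak_URVG: "URVG G \<Longrightarrow> weak_URVG G"
  by (auto simp: URVG_def weak_URVG_def)

theorem theorem5p1:
  fixes m n :: nat and G :: "('a, 'b) pre_digraph"
  assumes "1 \<le> m" and "m \<le> n"
    and "complete_bipartite_digraph m n G"
  shows "((m \<le> 2 \<and> n \<le> 6) \<or> (m = 3 \<and> n \<le> 4) \<longrightarrow> URVG G) \<and>
         (m \<le> 2 \<or> (m \<le> 3 \<and> n \<le> 4) \<longrightarrow> weak_URVG G)"
proof -
  have "URVG G" if "(m \<le> 2 \<and> n \<le> 6) \<or> (m = 3 \<and> n \<le> 4)"
  proof -
    from that assms(1) consider "m = 1" "n \<le> 6" | "m = 2" "n \<le> 6" | "m = 3" "n \<le> 4"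
      by linarith
    then show ?thesis
      using assms(3) by cases (auto intro: URVG_K_1_n URVG_K_2_n URVG_K_3_n)
  qed
  moreover have "weak_URVG G" if "m \<le> 2"
    using weak_URVG_K_2_n assms(3) that .
  \<comment> \<open>The staircase leaves only \<open>m = 3\<close> with \<open>n \<le> 4\<close>,
    where the exact representation is in particular a weak one.\<close>
  moreover have "m = 3" if "m \<le> 3" "\<not> m \<le> 2"
    using that by simp
  ultimately show ?thesis
    using URVG_imp_weak_URVG by blast
qed

end
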